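(* Let $p(x)=x^{n+1}+\cdots\in\mathbb{C}[x]$ be a monic polynomial of degree $n+1$, $n\ge1$, whose critical values $t_1,\dots,t_n$ (counted with multiplicity) satisfy $$t_1+\cdots+t_n=0,\qquad \max_{j}|t_j|=1.$$ Then there exists $a\in\mathbb{C}$ such that $p(x+a)=x^{n+1}+\sum_{j=0}^{n}p_jx^j$ with $$\sum_{j=0}^n|p_j|\le 8^{n+1}.$$
   Context: The critical values of $p$ are the values of $p$ at the $n$ roots (with multiplicity) of $p'$. *)

theory Defs
  imports "HOL-Computational_Algebra.Computational_Algebra" Complex_Main
begin

definition critical_values :: "complex poly \<Rightarrow> complex multiset" where
  "critical_values p = image_mset (poly p) (proots (pderiv p))"

end

theory Submission
  imports Defs "HOL-Complex_Analysis.Complex_Analysis"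
begin

text \<open>All roots lie within distance 4 of any fixed root \<open>a\<close>, so the coefficients of \<open>p(x + a)\<close> sum to
  at most \<open>5 ^ degree p\<close> in modulus. To see this, note that a circle about \<open>a\<close> which separates the
  roots must meet \<open>{\<bar>p\<bar> \<le> 1}\<close>: outside that set \<open>p\<close> is a covering of \<open>{\<bar>w\<bar> > 1}\<close>, so \<open>p\<close> has a
  continuous root of order \<open>degree p\<close> on the circle and the number of enclosed roots is a multiple
  of \<open>degree p\<close>. Replacing the roots by their distances to \<open>a\<close> then gives a monic real polynomial
  bounded by 1 on \<open>[0, L]\<close>, where \<open>L\<close> is the distance from \<open>a\<close> to another root, and Chebyshev's
  bound yields \<open>L \<le> 4\<close>.\<close>

section \<open>Regular fibres and the covering property of a polynomial\<close>

lemma card_roots_rsquarefree: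
  fixes p :: "complex poly"
  assumes "rsquarefree p"
  shows "card {z. poly p z = 0} = degree p"
proof -
  have p: "p \<noteq> 0" using assms by (simp add: rsquarefree_def)
  have "degree p = (\<Sum>z\<in>{z. poly p z = 0}. count (proots p) z)"
    using size_proots_complex[of p] p by (simp add: size_multiset_overloaded_eq)
  also have "\<dots> = (\<Sum>z\<in>{z. poly p z = 0}. 1)"
    using assms p by (intro sum.cong) (auto simp: rsquarefree_root_order)
  finally show ?thesis by simp
qed

lemma degree_diff_const:
  fixes p :: "'a::comm_ring_1 poly"
  assumes "degree p > 0"
  shows "degree (p - [:w:]) = degree p"
proof -
  have "degree (p + [:- w:]) = degree p"
    using assms by (intro degree_add_eq_left) simp
  moreover have "p + [:- w:] = p - [:w:]" by (simp add: poly_eq_iff coeff_pCons split: nat.splits)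
  ultimately show ?thesis by simp
qed

lemma card_poly_fibre:
  fixes p :: "complex poly"
  assumes "degree p > 0" "\<And>z. poly p z = w \<Longrightarrow> poly (pderiv p) z \<noteq> 0"
  shows "card {z. poly p z = w} = degree p"
proof -
  have "pderiv (p - [:w:]) = pderiv p" by (simp add: pderiv_diff pderiv_pCons)
  then have "rsquarefree (p - [:w:])"
    using assms(2) by (auto simp: rsquarefree_roots)
  from card_roots_rsquarefree[OF this]
  show ?thesis using degree_diff_const[OF assms(1)] by simp
qed

text \<open>All fibres over \<open>S\<close> have the same size \<open>degree p\<close>. Around a
  fibre there are disjoint discs on which \<open>p\<close> is injective, and the intersection of
  their open images is evenly covered, because counting leaves no room for preimages outside the
  discs.\<close>

lemma covering_space_poly:
  fixes p :: "complex poly"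
  assumes deg: "degree p > 0" and S: "open S"
    and reg: "\<And>z. poly p z \<in> S \<Longrightarrow> poly (pderiv p) z \<noteq> 0"
  shows "covering_space (poly p -` S) (poly p) S"
proof
  show "continuous_on (poly p -` S) (poly p)" by (intro continuous_intros)
  have openpre: "open (poly p -` T)" if "open T" for T
    using that by (intro open_vimage continuous_intros)
  show "poly p ` (poly p -` S) = S"
  proof -
    have "w \<in> range (poly p)" for w
    proof -
      obtain z where "poly (p - [:w:]) z = 0"
        using alg_closed_imp_poly_has_root[of "p - [:w:]"] degree_diff_const[OF deg] deg by auto
      then show ?thesis by (intro image_eqI[of _ _ z]) auto
    qed
    then show ?thesis by auto
  qed
  fix w assume w: "w \<in> S"
  define F where "F = {z. poly p z = w}"
  have cardF: "card F = degree p"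
    unfolding F_def using w reg by (intro card_poly_fibre deg) auto
  have finF: "finite F" using cardF deg card_gt_0_iff by metis
  have "\<exists>r>0. inj_on (poly p) (ball z r)" if "z \<in> F" for z
  proof -
    have "deriv (poly p) z \<noteq> 0"
      using reg[of z] w that by (simp add: F_def DERIV_imp_deriv[OF poly_DERIV])
    moreover have "poly p holomorphic_on UNIV" by (intro poly_holomorphic_on holomorphic_on_ident)
    ultimately show ?thesis
      using has_complex_derivative_locally_injective[OF _ UNIV_I open_UNIV] by blast
  qed
  then obtain r where r: "\<And>z. z \<in> F \<Longrightarrow> r z > 0 \<and> inj_on (poly p) (ball z (r z))"
    by metis
  obtain e where e: "\<And>x. e x > 0" "\<And>x y. y \<in> F \<Longrightarrow> x \<noteq> y \<Longrightarrow> e x \<le> dist x y"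
    using finite_set_avoid[OF finF] by metis
  define B where "B = (\<lambda>z. ball z (min (r z) (e z / 2)))"
  have injB: "inj_on (poly p) (B z)" if "z \<in> F" for z
    using r[OF that] by (auto simp: B_def inj_on_def)
  have openB: "open (B z)" for z by (simp add: B_def)
  have disjB: "B x \<inter> B y = {}" if "x \<in> F" "y \<in> F" "x \<noteq> y" for x y
  proof -
    have "False" if "u \<in> B x" "u \<in> B y" for u
      using that e(2)[OF \<open>y \<in> F\<close> \<open>x \<noteq> y\<close>] e(2)[of x y] \<open>x \<in> F\<close> \<open>x \<noteq> y\<close> dist_triangle2[of x y u]
      by (auto simp: B_def dist_commute)
    then show ?thesis by auto
  qed
  define T where "T = S \<inter> (\<Inter>z\<in>F. poly p ` B z)"
  have "open T"
    unfolding T_def using finF S injB openB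
    by (intro open_Int open_INT ballI open_mapping_thm3 poly_holomorphic_on) auto
  have "w \<in> T"
    using w r e(1) by (force simp: T_def F_def B_def)
  have cover: "\<exists>z\<in>F. u \<in> B z" if "poly p u \<in> T" for u
  proof -
    \<comment> \<open>One preimage of \<open>poly p u\<close> in each of the \<open>degree p\<close>
      disjoint discs already exhausts the fibre, so \<open>u\<close> itself is one of them.\<close>
    have "\<forall>z\<in>F. \<exists>x\<in>B z. poly p x = poly p u"
      using that by (force simp: T_def)
    then obtain s where s: "\<And>z. z \<in> F \<Longrightarrow> s z \<in> B z \<and> poly p (s z) = poly p u"
      by metis
    have "inj_on s F"
      using s disjB by (fastforce simp: inj_on_def)
    have *: "card {x. poly p x = poly p u} = degree p"
      using that reg by (intro card_poly_fibre deg) (auto simp: T_def)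
    then have "finite {x. poly p x = poly p u}" using deg card_gt_0_iff by metis
    moreover have "s ` F \<subseteq> {x. poly p x = poly p u}" using s by auto
    moreover have "card (s ` F) = card {x. poly p x = poly p u}"
      using card_image[OF \<open>inj_on s F\<close>] * cardF by simp
    ultimately have "s ` F = {x. poly p x = poly p u}" by (rule card_subset_eq)
    then have "u \<in> s ` F" by simp
    then show ?thesis using s by auto
  qed
  define V where "V = (\<lambda>z. B z \<inter> poly p -` T) ` F"
  show "\<exists>T. w \<in> T \<and> openin (top_of_set S) T \<and>
             (\<exists>v. \<Union>v = poly p -` S \<inter> poly p -` T \<and>
               (\<forall>u\<in>v. openin (top_of_set (poly p -` S)) u) \<and>
               pairwise disjnt v \<and> (\<forall>u\<in>v. \<exists>q. homeomorphism u T (poly p) q))"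
  proof (intro exI[of _ T] exI[of _ V] conjI ballI)
    show "w \<in> T" by fact
    show "openin (top_of_set S) T" using \<open>open T\<close> S by (auto simp: openin_open_eq T_def)
    show "\<Union>V = poly p -` S \<inter> poly p -` T"
      using cover by (auto simp: V_def T_def)
    show "openin (top_of_set (poly p -` S)) u" if "u \<in> V" for u
    proof (rule open_subset)
      show "u \<subseteq> poly p -` S" using that by (auto simp: V_def T_def)
      show "open u" using that openB openpre[OF \<open>open T\<close>] by (auto simp: V_def)
    qed
    show "pairwise disjnt V"
      using disjB by (fastforce simp: V_def pairwise_def disjnt_def)
    show "\<exists>q. homeomorphism u T (poly p) q" if "u \<in> V" for u
    proof -
      from that obtain z where z: "z \<in> F" and u: "u = B z \<inter> poly p -` T" by (auto simp: V_def)
      have "open u" unfolding u using openB openpre \<open>open T\<close> by auto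
      have "inj_on (poly p) u" using injB[OF z] by (auto simp: u inj_on_def)
      have "T \<subseteq> poly p ` B z" using z by (auto simp: T_def)
      then have "poly p ` u = T" unfolding u by blast
      show ?thesis
        using invariance_of_domain_homeomorphism[OF \<open>open u\<close> _ order_refl \<open>inj_on (poly p) u\<close>]
          continuous_on_poly[OF continuous_on_id] \<open>poly p ` u = T\<close> by blast
    qed
  qed
qed

section \<open>A continuous root of \<open>p\<close> where its modulus exceeds 1\<close>

text \<open>The quotient is the reversed polynomial at \<open>1/z\<close>, which is continuous at 0
  with value the leading coefficient 1. The bound 1 is chosen so that the quotient has a continuous
  principal logarithm.\<close>

lemma monic_poly_asymptotics:
  fixes p :: "complex poly"
  assumes "lead_coeff p = 1"
  obtains r where "r > 0"
    "\<And>z. norm z \<ge> r \<Longrightarrow> norm (poly p z / z ^ degree p - 1) < 1"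
proof -
  have "isCont (poly (reflect_poly p)) 0" by simp
  then have "\<forall>e>0. \<exists>s>0. \<forall>x. dist x 0 < s \<longrightarrow>
      dist (poly (reflect_poly p) x) (poly (reflect_poly p) 0) < e"
    unfolding continuous_at_eps_delta .
  then obtain s where s: "s > 0"
    "\<And>x. norm x < s \<Longrightarrow> norm (poly (reflect_poly p) x - 1) < 1"
    using assms by (metis dist_norm diff_zero poly_reflect_poly_0 zero_less_one)
  show ?thesis
  proof
    show "2 / s > 0" using s(1) by simp
    fix z :: complex assume z: "norm z \<ge> 2 / s"
    have "norm z > 0" using z s(1) by (smt (verit) divide_pos_pos)
    then have "z \<noteq> 0" by auto
    have "norm (inverse z) < s"
      using z s(1) \<open>norm z > 0\<close> by (simp add: norm_divide field_simps)
    from s(2)[OF this] show "norm (poly p z / z ^ degree p - 1) < 1"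
      using \<open>z \<noteq> 0\<close> by (simp add: poly_reflect_poly_nz field_simps)
  qed
qed

text \<open>The source of the continuous logarithms below: such values lie in the open right
  half-plane, away from the branch cut of \<open>Ln\<close>.\<close>

lemma one_minus_notin_nonpos_Reals:
  fixes w :: complex
  assumes "norm w < 1"
  shows "1 - w \<notin> \<real>\<^sub>\<le>\<^sub>0"
proof -
  have "Re (1 - w) > 0" using assms abs_Re_le_cmod[of w] by simp
  then show ?thesis by (auto simp: complex_nonpos_Reals_iff)
qed

text \<open>Scaling the values of \<open>p\<close> up by a large factor moves the lifted points to where
  \<open>p\<close> is close to \<open>z ^ degree p\<close>, which has an obvious root.\<close>

lemma poly_has_continuous_root:
  fixes p :: "complex poly"
  assumes deg: "degree p > 0" and monic: "lead_coeff p = 1"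
    and crit: "\<And>z. poly (pderiv p) z = 0 \<Longrightarrow> norm (poly p z) \<le> 1"
    and U: "\<And>z. z \<in> U \<Longrightarrow> norm (poly p z) > 1"
  obtains H where "continuous_on U H" "\<And>z. z \<in> U \<Longrightarrow> H z ^ degree p = poly p z"
proof -
  let ?d = "degree p"
  define S where "S = {w::complex. norm w > 1}"
  have "open S" unfolding S_def by (intro open_Collect_less continuous_intros)
  then have cov: "covering_space (poly p -` S) (poly p) S"
    using crit using S_def by (intro covering_space_poly deg) (auto simp: not_le[symmetric])
  obtain r where r: "r > 0" "\<And>z. norm z \<ge> r \<Longrightarrow> norm (poly p z / z ^ ?d - 1) < 1"
    using monic_poly_asymptotics[OF monic] by blast
  have "compact (poly p ` cball 0 r)"
    by (intro compact_continuous_image continuous_intros compact_cball)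
  then obtain M0 where M0: "\<And>z. norm z \<le> r \<Longrightarrow> norm (poly p z) \<le> M0"
    using compact_imp_bounded bounded_iff by (metis image_eqI mem_cball_0)
  define M where "M = max 1 M0"
  have M: "M \<ge> 1" "\<And>z. norm z \<le> r \<Longrightarrow> norm (poly p z) \<le> M"
    using M0 by (force simp: M_def)+
  \<comment> \<open>At \<open>t = 0\<close> this is \<open>poly p z\<close>, which the identity
    lifts. The real factor is at least 1, so the homotopy stays in \<open>S\<close>; at
    \<open>t = 1\<close> it has modulus above \<open>M\<close>, which forces the lifted point out of
    the disc of radius \<open>r\<close>.\<close>
  define h where "h = (\<lambda>(t, z). of_real (1 + t * (M - 1)) * poly p z)"
  obtain k where contk: "continuous_on ({0..1} \<times> U) k"
    and pk: "\<And>z. z \<in> {0..1} \<times> U \<Longrightarrow> h z = poly p (k z)"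
  proof (rule covering_space_lift_homotopy[OF cov, of U h "\<lambda>z. z"])
    show "continuous_on ({0..1} \<times> U) h"
      unfolding h_def case_prod_unfold by (intro continuous_intros)
    show "h \<in> {0..1} \<times> U \<rightarrow> S"
    proof (clarsimp simp: h_def S_def norm_mult simp del: of_real_add of_real_mult of_real_diff)
      fix t :: real and z assume t: "0 \<le> t" "t \<le> 1" and "z \<in> U"
      have "1 * 1 < norm (poly p z) * (1 + t * (M - 1))"
        using U[OF \<open>z \<in> U\<close>] t M(1) by (intro mult_less_le_imp_less) auto
      moreover have "0 \<le> t * (M - 1)" using t M(1) by simp
      ultimately show "1 < \<bar>1 + t * (M - 1)\<bar> * norm (poly p z)" by (simp add: mult.commute)
    qed
  qed (use U in \<open>auto simp: h_def S_def\<close>)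
  define K where "K = (\<lambda>z. k (1, z))"
  have contK: "continuous_on U K"
    unfolding K_def by (rule continuous_on_compose2[OF contk]) (auto intro!: continuous_intros)
  have pK: "poly p (K z) = of_real M * poly p z" if "z \<in> U" for z
    using pk[of "(1, z)"] that by (simp add: h_def K_def)
  have Kr: "norm (K z) > r" if "z \<in> U" for z
  proof (rule ccontr)
    assume "\<not> norm (K z) > r"
    then have "norm (poly p (K z)) \<le> M" using M(2) by simp
    moreover have "M * 1 < M * norm (poly p z)" using U[OF that] M(1) by (intro mult_strict_left_mono) auto
    ultimately show False using M(1) by (simp add: pK[OF that] norm_mult)
  qed
  have Knz: "K z \<noteq> 0" if "z \<in> U" for z using Kr[OF that] r(1) by auto
  define q where "q = (\<lambda>z. poly p (K z) / K z ^ ?d)"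
  have q: "q z \<notin> \<real>\<^sub>\<le>\<^sub>0" if "z \<in> U" for z
  proof -
    have "norm (1 - q z) < 1"
      unfolding q_def using r(2) Kr[OF that] by (subst norm_minus_commute) simp
    from one_minus_notin_nonpos_Reals[OF this] show ?thesis by simp
  qed
  \<comment> \<open>The first two factors give a root of order \<open>degree p\<close> of
    \<open>poly p (K z) = M * poly p z\<close>; the constant last factor removes
    \<open>M\<close>.\<close>
  define H where "H = (\<lambda>z. K z * exp (Ln (q z) / of_nat ?d) * exp (- Ln (of_real M) / of_nat ?d))"
  show ?thesis
  proof
    have "continuous_on U q"
      unfolding q_def using Knz by (intro continuous_intros contK) auto
    then show "continuous_on U H"
      unfolding H_def using deg q by (intro continuous_intros contK) auto
    fix z assume z: "z \<in> U"
    have ex: "exp (x / of_nat ?d) ^ ?d = exp x" for x :: complex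
      using deg by (simp flip: exp_of_nat_mult)
    have "q z \<noteq> 0" using q[OF z] by auto
    then have "H z ^ ?d = K z ^ ?d * q z * (1 / of_real M)"
      using M(1) unfolding H_def power_mult_distrib ex by (simp add: exp_minus field_simps)
    also have "\<dots> = poly p z"
      using Knz[OF z] M(1) by (simp add: q_def pK[OF z])
    finally show "H z ^ ?d = poly p z" .
  qed
qed

section \<open>Winding numbers of products of linear factors on a circle\<close>

text \<open>Pulling out \<open>z - a\<close> or \<open>a - r\<close>, whichever is larger in modulus
  on the circle, leaves \<open>1 - w\<close> with \<open>norm w < 1\<close>, and this has a
  principal logarithm. So a linear factor winds once if its root is enclosed and not at all
  otherwise.\<close>

lemma linear_factor_log_on_sphere:
  fixes a r :: complex
  assumes "s > 0" "dist a r \<noteq> s"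
  obtains g where "continuous_on (sphere a s) g"
    "\<And>z. z \<in> sphere a s \<Longrightarrow> z - r = (if dist a r < s then z - a else 1) * exp (g z)"
proof (cases "dist a r < s")
  case True
  let ?u = "\<lambda>z. 1 - (r - a) / (z - a)"
  have za: "z \<noteq> a" if "z \<in> sphere a s" for z using that assms(1) by auto
  have u: "?u z \<notin> \<real>\<^sub>\<le>\<^sub>0" if "z \<in> sphere a s" for z
    using that True assms(1)
    by (intro one_minus_notin_nonpos_Reals) (simp add: norm_divide dist_norm norm_minus_commute)
  show ?thesis
  proof (rule that[of "\<lambda>z. Ln (?u z)"])
    show "continuous_on (sphere a s) (\<lambda>z. Ln (?u z))"
      using za u by (intro continuous_intros) auto
    show "z - r = (if dist a r < s then z - a else 1) * exp (Ln (?u z))" if "z \<in> sphere a s" for z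
    proof -
      have "exp (Ln (?u z)) = ?u z" using u[OF that] by (intro exp_Ln) auto
      then show ?thesis using True za[OF that] by (simp add: field_simps)
    qed
  qed
next
  case False
  with assms have ra: "dist a r > s" by simp
  then have "a \<noteq> r" using assms(1) by auto
  let ?u = "\<lambda>z. 1 - (z - a) / (r - a)"
  have u: "?u z \<notin> \<real>\<^sub>\<le>\<^sub>0" if "z \<in> sphere a s" for z
    using that ra assms(1)
    by (intro one_minus_notin_nonpos_Reals) (auto simp: norm_divide divide_less_eq dist_norm norm_minus_commute)
  show ?thesis
  proof (rule that[of "\<lambda>z. Ln (a - r) + Ln (?u z)"])
    show "continuous_on (sphere a s) (\<lambda>z. Ln (a - r) + Ln (?u z))"
      using \<open>a \<noteq> r\<close> u by (intro continuous_intros) auto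
    show "z - r = (if dist a r < s then z - a else 1) * exp (Ln (a - r) + Ln (?u z))"
      if "z \<in> sphere a s" for z
    proof -
      have "exp (Ln (?u z)) = ?u z" using u[OF that] by (intro exp_Ln) auto
      then show ?thesis using False \<open>a \<noteq> r\<close> by (simp add: exp_add field_simps)
    qed
  qed
qed

text \<open>An elementary argument principle: the exponent of \<open>z - a\<close> is the winding
  number of the product, namely the number of enclosed roots with multiplicity.\<close>

lemma prod_linear_factors_on_sphere:
  fixes a :: complex and A :: "complex multiset"
  assumes "s > 0" "\<And>r. r \<in># A \<Longrightarrow> dist a r \<noteq> s"
  shows "\<exists>g. continuous_on (sphere a s) g \<and> (\<forall>z\<in>sphere a s.
           (\<Prod>r\<in>#A. z - r) = (z - a) ^ size {#r \<in># A. dist a r < s#} * exp (g z))"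
  using assms(2)
proof (induction A)
  case empty
  show ?case by (intro exI[of _ "\<lambda>_. 0"]) auto
next
  case (add r A)
  then obtain g where g: "continuous_on (sphere a s) g" "\<And>z. z \<in> sphere a s \<Longrightarrow>
      (\<Prod>r\<in>#A. z - r) = (z - a) ^ size {#r \<in># A. dist a r < s#} * exp (g z)"
    by auto
  have "dist a r \<noteq> s" using add.prems by simp
  then obtain f where f: "continuous_on (sphere a s) f"
    "\<And>z. z \<in> sphere a s \<Longrightarrow> z - r = (if dist a r < s then z - a else 1) * exp (f z)"
    using linear_factor_log_on_sphere[OF assms(1)] by metis
  show ?case
  proof (intro exI[of _ "\<lambda>z. f z + g z"] conjI ballI)
    show "continuous_on (sphere a s) (\<lambda>z. f z + g z)" by (intro continuous_intros f g)
    fix z assume z: "z \<in> sphere a s"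
    have "(\<Prod>r\<in>#add_mset r A. z - r) = (z - r) * (\<Prod>r\<in>#A. z - r)" by simp
    also have "\<dots> = (z - a) ^ size {#r \<in># add_mset r A. dist a r < s#} * exp (f z + g z)"
      by (subst f(2)[OF z], subst g(2)[OF z]) (simp add: exp_add)
    finally show "(\<Prod>r\<in>#add_mset r A. z - r) =
      (z - a) ^ size {#r \<in># add_mset r A. dist a r < s#} * exp (f z + g z)" .
  qed
qed

text \<open>The right-hand side winds \<open>k\<close> times around 0, whereas the winding number of
  a \<open>d\<close>-th power is a multiple of \<open>d\<close>.\<close>

lemma no_continuous_root_on_sphere:
  fixes a :: complex
  assumes s: "s > 0" and k: "0 < k" "k < d"
    and H: "continuous_on (sphere a s) H" and g: "continuous_on (sphere a s) g"
    and eq: "\<And>z. z \<in> sphere a s \<Longrightarrow> H z ^ d = (z - a) ^ k * exp (g z)"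
  shows False
proof -
  have d: "d > 0" using k by simp
  define c where "c = (\<lambda>t. a + of_real s * exp (2 * pi * \<i> * of_real t))"
  have cs: "c t \<in> sphere a s" for t
    using s by (simp add: c_def dist_norm norm_mult)
  \<comment> \<open>Along the loop, \<open>H\<close> is divided by continuous \<open>d\<close>-th
    roots of \<open>exp (g z)\<close> and of the rotating part of \<open>(z - a) ^ k\<close>. What
    remains takes values among the finitely many \<open>d\<close>-th roots of \<open>s ^ k\<close>,
    hence is constant.\<close>
  define f where "f = (\<lambda>t. H (c t) * exp (- g (c t) / of_nat d)
                          * exp (- (2 * pi * \<i> * of_real t * of_nat k) / of_nat d))"
  have ex: "exp (x / of_nat d) ^ d = exp x" for x :: complex
    using d by (simp flip: exp_of_nat_mult)
  have fd: "f t ^ d = of_real s ^ k" for t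
  proof -
    have "f t ^ d = H (c t) ^ d * exp (- g (c t)) * exp (- (2 * pi * \<i> * of_real t * of_nat k))"
      unfolding f_def power_mult_distrib ex ..
    also have "\<dots> = (c t - a) ^ k * exp (- (2 * pi * \<i> * of_real t * of_nat k))"
      by (simp add: eq[OF cs] exp_minus)
    also have "\<dots> = of_real s ^ k"
      by (simp add: c_def power_mult_distrib exp_minus flip: exp_of_nat_mult) (simp add: mult_ac)
    finally show ?thesis .
  qed
  have contc: "continuous_on {0..1} c" unfolding c_def by (intro continuous_intros)
  have "continuous_on {0..1} (\<lambda>t. H (c t))" "continuous_on {0..1} (\<lambda>t. g (c t))"
    by (rule continuous_on_compose2[OF H contc] continuous_on_compose2[OF g contc], use cs in auto)+
  then have "continuous_on {0..1} f"
    unfolding f_def using d by (intro continuous_intros) auto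
  moreover have "finite (f ` {0..1})"
  proof (rule finite_subset)
    show "f ` {0..1} \<subseteq> {z. z ^ d = of_real s ^ k}" using fd by auto
    show "finite {z. z ^ d = (of_real s ^ k :: complex)}"
      using d by (rule finite_nth_roots)
  qed
  ultimately have "f constant_on {0..1}"
    by (intro continuous_finite_range_constant) auto
  then have "f 0 = f 1" unfolding constant_on_def by (metis atLeastAtMost_iff order_refl zero_le_one)
  have "c 1 = c 0" by (simp add: c_def exp_two_pi_i)
  have "f 0 \<noteq> 0" using fd[of 0] s d by (metis power_eq_0_iff zero_power of_real_eq_0_iff less_irrefl)
  \<comment> \<open>Only the explicit rotation fails to close up after one turn; since
    \<open>f\<close> is constant, its jump must be 1, which forces \<open>d\<close> to divide
    \<open>k\<close>.\<close>
  have "f 1 = f 0 * exp (- (2 * pi * \<i> * of_nat k) / of_nat d)"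
    by (simp add: f_def \<open>c 1 = c 0\<close>)
  with \<open>f 0 = f 1\<close> \<open>f 0 \<noteq> 0\<close> have "exp (- (2 * pi * \<i> * of_nat k) / of_nat d) = 1"
    by simp
  then obtain n :: int where "- (2 * pi * real k / real d) = of_int (2 * n) * pi"
    using exp_eq_1 by (auto simp: field_simps)
  then have "pi * real k = pi * (real_of_int (- n) * real d)"
    using d by (simp add: field_simps)
  then have "real k = real_of_int (- n) * real d" using pi_neq_zero mult_left_cancel by blast
  then have "int k = - n * int d" by (metis of_int_eq_iff of_int_mult of_int_of_nat_eq)
  then have "int d dvd int k" by simp
  then show False using k by (auto dest: dvd_imp_le)
qed

section \<open>Circles about a root, and the distance between two roots\<close>

lemma poly_eq_prod_mset_proots:
  fixes p :: "complex poly"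
  assumes "lead_coeff p = 1"
  shows "poly p z = (\<Prod>r\<in>#proots p. z - r)"
proof -
  have "poly (\<Prod>r\<in>#A. [:- r, 1:]) z = (\<Prod>r\<in>#A. z - r)" for A :: "complex multiset"
    by (induction A) (auto simp: algebra_simps)
  then show ?thesis using complex_poly_decompose_multiset[of p] assms by (metis smult_1_left)
qed

text \<open>A circle missing the sublevel set encloses \<open>a\<close> but not \<open>b\<close>, so
  the number of enclosed roots lies strictly between 0 and \<open>degree p\<close>; a continuous
  root of order \<open>degree p\<close> on the circle rules this out.\<close>

lemma circle_meets_sublevel_set:
  fixes p :: "complex poly"
  assumes monic: "lead_coeff p = 1"
    and crit: "\<And>z. poly (pderiv p) z = 0 \<Longrightarrow> norm (poly p z) \<le> 1"
    and a: "poly p a = 0" and b: "poly p b = 0" and s: "0 \<le> s" "s \<le> dist a b"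
  shows "\<exists>z\<in>sphere a s. norm (poly p z) \<le> 1"
proof (rule ccontr)
  assume "\<not> ?thesis"
  then have big: "\<And>z. z \<in> sphere a s \<Longrightarrow> norm (poly p z) > 1" by (auto simp: not_le)
  have "p \<noteq> 0" using monic by auto
  \<comment> \<open>A root on the circle would itself belong to the sublevel set. Applied to
    \<open>a\<close> and \<open>b\<close>, this makes both bounds on \<open>s\<close>
    strict.\<close>
  have off: "dist a r \<noteq> s" if "poly p r = 0" for r using big[of r] that by auto
  have s0: "s > 0" using off[OF a] s by simp
  have sb: "s < dist a b" using off[OF b] s by simp
  let ?k = "size {#r \<in># proots p. dist a r < s#}"
  obtain g where g: "continuous_on (sphere a s) g"
    "\<And>z. z \<in> sphere a s \<Longrightarrow> poly p z = (z - a) ^ ?k * exp (g z)"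
    using prod_linear_factors_on_sphere[OF s0, of "proots p" a] off \<open>p \<noteq> 0\<close>
    unfolding poly_eq_prod_mset_proots[OF monic] by auto
  have "degree p > 0"
    using a monic by (auto intro!: Nat.gr0I elim!: degree_eq_zeroE)
  then obtain H where H: "continuous_on (sphere a s) H"
    "\<And>z. z \<in> sphere a s \<Longrightarrow> H z ^ degree p = poly p z"
    using poly_has_continuous_root[OF _ monic crit big] by blast
  have ain: "a \<in># {#r \<in># proots p. dist a r < s#}" using a s0 \<open>p \<noteq> 0\<close> by simp
  have "{#r \<in># proots p. dist a r < s#} \<subset># proots p"
  proof -
    have "b \<in># proots p" using b \<open>p \<noteq> 0\<close> by simp
    moreover have "b \<notin># {#r \<in># proots p. dist a r < s#}" using sb by simp
    ultimately show ?thesis by (metis multiset_filter_subset subset_mset.le_neq_trans)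
  qed
  then have "?k < degree p" using mset_subset_size size_proots_complex by metis
  moreover have "?k > 0" using ain nonempty_has_size by fastforce
  ultimately show False
    using no_continuous_root_on_sphere[OF s0 _ _ H(1) g(1)] H(2) g(2) by metis
qed

text \<open>With \<open>x = L/4 * (2 + u + 1/u)\<close>, which runs through \<open>[0, L]\<close> on the unit circle, the
  product of the \<open>x - r\<close> times a power of \<open>u\<close> is a polynomial in \<open>u\<close> with constant term
  \<open>(L/4)\<close> to the number of factors.\<close>

lemma interval_length_le_4:
  fixes A :: "real multiset"
  assumes L: "L \<ge> 0" and A: "A \<noteq> {#}"
    and bd: "\<And>x. 0 \<le> x \<Longrightarrow> x \<le> L \<Longrightarrow> (\<Prod>r\<in>#A. \<bar>x - r\<bar>) \<le> 1"
  shows "L \<le> 4"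
proof -
  define Q where "Q = (\<Prod>r\<in>#A. smult (of_real (L / 4)) ([:1, 1:] ^ 2) - [:0, of_real r:] :: complex poly)"
  have polyQ: "poly Q u = (\<Prod>r\<in>#A. of_real (L / 4) * (u + 1) ^ 2 - of_real r * u)" for u
    unfolding Q_def by (induction A) (auto simp: algebra_simps power2_eq_square)
  \<comment> \<open>The maximum modulus principle carries the bound from the unit circle to the
    centre, where only the constant term survives.\<close>
  have "norm (poly Q 0) \<le> 1"
  proof (rule maximum_modulus_frontier[of "poly Q" "cball 0 1"])
    fix u :: complex assume "u \<in> frontier (cball 0 1)"
    then have u: "norm u = 1" by (simp add: frontier_cball)
    \<comment> \<open>On the unit circle \<open>u + 1/u = 2 * Re u\<close>, so this is the
      substitution in real form.\<close>
    define x where "x = L / 2 * (1 + Re u)"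
    have "u * cnj u = 1" using u by (simp add: complex_mult_cnj cmod_def)
    have "of_real (L / 4) * (u + 1) ^ 2 - of_real r * u = u * of_real (x - r)" for r
    proof -
      have cnj: "cnj u = 2 * complex_of_real (Re u) - u" by (simp add: complex_eq_iff)
      have "u * of_real (x - r) = of_real (L / 4) * (2 * u + u * u + u * cnj u) - of_real r * u"
        unfolding cnj x_def by (simp add: field_simps)
      also have "\<dots> = of_real (L / 4) * (u + 1) ^ 2 - of_real r * u"
        unfolding \<open>u * cnj u = 1\<close> by (simp add: power2_eq_square algebra_simps)
      finally show ?thesis by simp
    qed
    then have "norm (poly Q u) = norm (\<Prod>r\<in>#A. u * of_real (x - r))" by (simp add: polyQ)
    also have "\<dots> = (\<Prod>r\<in>#A. \<bar>x - r\<bar>)"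
      by (induction A) (simp_all add: norm_mult u del: of_real_diff)
    also have "\<dots> \<le> 1"
    proof (rule bd)
      have "\<bar>Re u\<bar> \<le> 1" using abs_Re_le_cmod[of u] u by simp
      then have "0 \<le> 1 + Re u" "1 + Re u \<le> 2" by auto
      then show "0 \<le> x" "x \<le> L" using L mult_left_mono[of "1 + Re u" 2 "L / 2"] by (auto simp: x_def)
    qed
    finally show "norm (poly Q u) \<le> 1" .
  qed (auto intro!: continuous_intros poly_holomorphic_on)
  also have "norm (poly Q 0) = (L / 4) ^ size A"
    unfolding polyQ using L by (induction A) (auto simp: norm_mult)
  finally have "(L / 4) ^ size A \<le> 1" .
  then have "L / 4 \<le> 1"
    using A L by (meson linorder_not_le nonempty_has_size one_less_power)
  then show ?thesis by simp
qed

text \<open>Circular projection about \<open>a\<close> does not increase the distances to the roots.\<close>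

lemma dist_roots_le_4:
  fixes p :: "complex poly"
  assumes monic: "lead_coeff p = 1"
    and crit: "\<And>z. poly (pderiv p) z = 0 \<Longrightarrow> norm (poly p z) \<le> 1"
    and a: "poly p a = 0" and b: "poly p b = 0"
  shows "dist a b \<le> 4"
proof (rule interval_length_le_4)
  have "p \<noteq> 0" using monic by auto
  then have "a \<in># proots p" using a by simp
  then show "image_mset (dist a) (proots p) \<noteq> {#}" by auto
  fix x assume "0 \<le> x" "x \<le> dist a b"
  then obtain z where z: "dist a z = x" "norm (poly p z) \<le> 1"
    using circle_meets_sublevel_set[OF assms, of x] by auto
  have "(\<Prod>r\<in>#image_mset (dist a) A. \<bar>x - r\<bar>) \<le> norm (\<Prod>r\<in>#A. z - r)" for A
  proof (induction A)
    case (add r A)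
    have "\<bar>x - dist a r\<bar> \<le> norm (z - r)"
      using abs_dist_diff_le[of z a r] z(1) by (simp add: dist_commute[of z a] dist_norm[of z r])
    moreover have "0 \<le> (\<Prod>r\<in>#image_mset (dist a) A. \<bar>x - r\<bar>)"
      by (induction A) auto
    ultimately show ?case using add by (auto simp: norm_mult intro!: mult_mono)
  qed auto
  from this[of "proots p"] show "(\<Prod>r\<in>#image_mset (dist a) (proots p). \<bar>x - r\<bar>) \<le> 1"
    using z(2) by (simp add: poly_eq_prod_mset_proots[OF monic])
qed simp

section \<open>From the location of the roots to the coefficients\<close>

text \<open>The sum of the moduli of the coefficients is submultiplicative, and the factor
  \<open>[:- r, 1:]\<close> contributes \<open>1 + norm r\<close>. A free cut-off \<open>N\<close>
  allows the leading coefficient to be left out later.\<close>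

lemma sum_norm_coeff_prod_linear_le:
  fixes A :: "complex multiset"
  shows "(\<Sum>j\<le>N. norm (coeff (\<Prod>r\<in>#A. [:- r, 1:]) j)) \<le> (\<Prod>r\<in>#A. 1 + norm r)"
proof (induction A)
  case empty
  have "(\<Sum>j\<le>N. norm (coeff 1 j :: complex)) = (\<Sum>j\<le>N. if j = 0 then 1 else 0)"
    by (intro sum.cong) auto
  then show ?case by simp
next
  case (add r A)
  let ?q = "\<Prod>r\<in>#A. [:- r, 1:]"
  let ?s = "\<Sum>j\<le>N. norm (coeff ?q j)"
  have eq: "(\<Prod>r\<in>#add_mset r A. [:- r, 1:]) = smult (- r) ?q + pCons 0 ?q" by simp
  have "(\<Sum>j\<le>N. norm (coeff (smult (- r) ?q + pCons 0 ?q) j))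
      \<le> (\<Sum>j\<le>N. norm r * norm (coeff ?q j) + norm (coeff (pCons 0 ?q) j))"
  proof (rule sum_mono)
    fix j
    show "norm (coeff (smult (- r) ?q + pCons 0 ?q) j)
        \<le> norm r * norm (coeff ?q j) + norm (coeff (pCons 0 ?q) j)"
      using norm_triangle_ineq[of "- r * coeff ?q j" "coeff (pCons 0 ?q) j"]
      by (simp only: coeff_add coeff_smult norm_mult norm_minus_cancel)
  qed
  also have "\<dots> = norm r * ?s + (\<Sum>j\<le>N. norm (coeff (pCons 0 ?q) j))"
    by (simp add: sum.distrib sum_distrib_left)
  also have "(\<Sum>j\<le>N. norm (coeff (pCons 0 ?q) j)) \<le> ?s"
  proof (cases N)
    case (Suc m)
    have "(\<Sum>j\<le>Suc m. norm (coeff (pCons 0 ?q) j)) = (\<Sum>j\<le>m. norm (coeff ?q j))"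
      by (subst sum.atMost_Suc_shift) simp
    also have "\<dots> \<le> (\<Sum>j\<le>Suc m. norm (coeff ?q j))" by simp
    finally show ?thesis by (simp add: Suc)
  qed simp
  finally have "(\<Sum>j\<le>N. norm (coeff (\<Prod>r\<in>#add_mset r A. [:- r, 1:]) j)) \<le> (1 + norm r) * ?s"
    unfolding eq by (simp add: algebra_simps)
  also have "\<dots> \<le> (1 + norm r) * (\<Prod>r\<in>#A. 1 + norm r)"
    by (intro mult_left_mono add.IH) simp
  finally show ?case by simp
qed

theorem corollary6:
  fixes p :: "complex poly" and n :: nat
  assumes "n \<ge> 1"
    and "degree p = n + 1" and "lead_coeff p = 1"
    and "(\<Sum>t\<in>#critical_values p. t) = 0"
    and "Max (cmod ` set_mset (critical_values p)) = 1"
  shows "\<exists>(a :: complex) (c :: nat \<Rightarrow> complex).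
           p \<circ>\<^sub>p [:a, 1:] = monom 1 (n + 1) + (\<Sum>j\<le>n. monom (c j) j)
         \<and> (\<Sum>j\<le>n. cmod (c j)) \<le> 8 ^ (n + 1)"
proof -
  have "p \<noteq> 0" using assms(3) by auto
  have "pderiv p \<noteq> 0" using assms(2) by (auto simp: pderiv_eq_0_iff)
  have crit: "cmod (poly p z) \<le> 1" if "poly (pderiv p) z = 0" for z
  proof -
    have "poly p z \<in># critical_values p"
      using that \<open>pderiv p \<noteq> 0\<close> by (auto simp: critical_values_def)
    then have "cmod (poly p z) \<le> Max (cmod ` set_mset (critical_values p))"
      by (intro Max_ge) auto
    then show ?thesis using assms(5) by simp
  qed
  have size: "size (proots p) = n + 1" using size_proots_complex[of p] assms(2) by simp
  \<comment> \<open>Any root serves as the centre: after the shift, every root has modulus at most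
    4.\<close>
  then obtain a where "a \<in># proots p" by (metis Suc_eq_plus1 size_eq_Suc_imp_elem)
  then have a: "poly p a = 0" using \<open>p \<noteq> 0\<close> by simp
  define q where "q = p \<circ>\<^sub>p [:a, 1:]"
  define A where "A = image_mset (\<lambda>r. r - a) (proots p)"
  have "(\<Prod>r\<in>#B. [:- r, 1:]) \<circ>\<^sub>p [:a, 1:] = (\<Prod>r\<in>#image_mset (\<lambda>r. r - a) B. [:- r, 1:])" for B
  proof (induction B)
    case (add r B)
    have "[:- r, 1:] \<circ>\<^sub>p [:a, 1:] = [:- (r - a), 1:]" by (simp add: pcompose_pCons)
    then show ?case using add by (simp add: pcompose_mult del: mult_pCons_left)
  qed (simp add: pcompose_1)
  from this[of "proots p"] have q: "q = (\<Prod>r\<in>#A. [:- r, 1:])"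
    using complex_poly_decompose_multiset[of p] assms(3) by (simp add: q_def A_def)
  have degq: "degree q = n + 1" using assms(2) by (simp add: q_def degree_pcompose)
  have lead: "coeff q (n + 1) = 1"
    using assms(2,3) degq lead_coeff_comp[of "[:a, 1:]" p] by (simp add: q_def)
  have "norm r \<le> 4" if "r \<in># A" for r
    using that dist_roots_le_4[OF assms(3) crit a] \<open>p \<noteq> 0\<close>
    by (auto simp: A_def dist_norm norm_minus_commute)
  \<comment> \<open>Each factor is in fact at most 5, which is rounded up to the 8 of the
    claim.\<close>
  then have "(\<Prod>r\<in>#A. 1 + norm r) \<le> 8 ^ size A"
  proof (induction A)
    case (add r A)
    then have "1 + norm r \<le> 8" "(\<Prod>r\<in>#A. 1 + norm r) \<le> 8 ^ size A" by force+
    moreover have "0 \<le> (\<Prod>r\<in>#A. 1 + norm r)" by (induction A) auto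
    ultimately show ?case by (auto intro!: mult_mono)
  qed auto
  then have "(\<Prod>r\<in>#A. 1 + norm r) \<le> 8 ^ (n + 1)" using size by (simp add: A_def)
  moreover have "(\<Sum>j\<le>n. norm (coeff q j)) \<le> (\<Prod>r\<in>#A. 1 + norm r)"
    unfolding q by (rule sum_norm_coeff_prod_linear_le)
  moreover have "q = monom 1 (n + 1) + (\<Sum>j\<le>n. monom (coeff q j) j)"
  proof -
    have "q = (\<Sum>j\<le>n + 1. monom (coeff q j) j)" using poly_as_sum_of_monoms[of q] degq by simp
    then show ?thesis using lead by (simp only: Suc_eq_plus1[symmetric] sum.atMost_Suc) (metis add.commute)
  qed
  ultimately show ?thesis
    by (intro exI[of _ a] exI[of _ "coeff q"]) (auto simp flip: q_def)
qed

end
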